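(* Let $X$ be a geodesic Ptolemy metric space and let $\Gamma \subset \mathrm{ISO}(X)$ be a subgroup of the isometry group acting properly and cocompactly on $X$. Then every finitely generated free abelian subgroup of $\Gamma$ is straight in $\Gamma$.
   Context: Metric spaces are nonempty; $|xy|$ denotes the distance between $x$ and $y$. A metric space $X$ is a Ptolemy metric space if $|xy|\,|uv| \le |xu|\,|yv| + |xv|\,|yu|$ for all $x,y,u,v \in X$. It is geodesic if any two points $x,y$ can be joined by a geodesic, i.e. a map $c:[a,b]\to X$ from $x$ to $y$ such that for some constant $\lambda \ge 0$, $|c(t)c(s)| = \lambda|t-s|$ for all $s,t$. $\mathrm{ISO}(X)$ is the isometry group of $X$. An isometric action of a group $\Gamma$ on $X$ is proper if for every $x \in X$ there is $r>0$ such that $\{\gamma \in \Gamma : |x\,\gamma(x)| < r\}$ is finite. It is cocompact if there is a compact subset $K \subset X$ with $X = \Gamma K$. A group acting properly and cocompactly by isometries on a geodesic space is finitely generated. For a finitely generated group $\Gamma$ with a finite generating set $\{\gamma_1,\dots,\gamma_k\}$, the word norm $|\gamma|_\Gamma$ of $\gamma \in \Gamma$ is the length of the shortest word in the $\gamma_i$ and $\gamma_i^{-1}$ representing $\gamma$. Two norms $|\cdot|^1, |\cdot|^2$ are equivalent if there is $c \ge 1$ with $\frac1c|\gamma|^1 \le |\gamma|^2 \le c|\gamma|^1$ for all $\gamma$; word norms for different finite generating sets are equivalent. A finitely generated subgroup $\Gamma_0 \subset \Gamma$ is straight in $\Gamma$ if $|\cdot|_{\Gamma_0}$ and (the restriction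 of) $|\cdot|_\Gamma$ are equivalent norms on $\Gamma_0$. *)

theory Defs
  imports "HOL-Analysis.Analysis" "HOL-Algebra.Generated_Groups" "HOL-Algebra.Free_Abelian_Groups"
begin

definition ptolemy :: "'a::metric_space set \<Rightarrow> bool" where
  "ptolemy X \<longleftrightarrow>
     (\<forall>x\<in>X. \<forall>y\<in>X. \<forall>u\<in>X. \<forall>v\<in>X. dist x y * dist u v \<le> dist x u * dist y v + dist x v * dist y u)"

definition geodesic_from_to ::
    "'a::metric_space set \<Rightarrow> (real \<Rightarrow> 'a) \<Rightarrow> real \<Rightarrow> real \<Rightarrow> 'a \<Rightarrow> 'a \<Rightarrow> bool" where
  "geodesic_from_to X c a b x y \<longleftrightarrow>
     a \<le> b \<and> c ` {a..b} \<subseteq> X \<and> c a = x \<and> c b = y \<and>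
     (\<exists>l\<ge>0. \<forall>s\<in>{a..b}. \<forall>t\<in>{a..b}. dist (c t) (c s) = l * \<bar>t - s\<bar>)"

definition geodesic_space :: "'a::metric_space set \<Rightarrow> bool" where
  "geodesic_space X \<longleftrightarrow> (\<forall>x\<in>X. \<forall>y\<in>X. \<exists>c a b. geodesic_from_to X c a b x y)"

text \<open>The space acted upon is a whole type, so that its isometries are plain functions and
  composition needs no restriction to a carrier.\<close>

definition iso_group :: "('a::metric_space \<Rightarrow> 'a) monoid" where
  "iso_group =
     \<lparr>carrier = {f. bij f \<and> (\<forall>x y. dist (f x) (f y) = dist x y)}, monoid.mult = (\<circ>), one = id\<rparr>"

lemma group_iso_group: "group iso_group"
proof (rule groupI)
  fix f :: "'a \<Rightarrow> 'a"
  assume f: "f \<in> carrier iso_group"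
  then have b: "bij f" and d: "\<And>x y. dist (f x) (f y) = dist x y"
    by (auto simp: iso_group_def)
  have "dist (inv_into UNIV f x) (inv_into UNIV f y) = dist x y" for x y
    using d[of "inv_into UNIV f x" "inv_into UNIV f y"] b by (simp add: bij_is_surj surj_f_inv_f)
  then show "\<exists>g\<in>carrier iso_group. g \<otimes>\<^bsub>iso_group\<^esub> f = \<one>\<^bsub>iso_group\<^esub>"
    using b by (intro bexI[of _ "inv_into UNIV f"])
      (auto simp: iso_group_def bij_imp_bij_inv bij_is_inj)
qed (auto simp: iso_group_def o_assoc intro: bij_comp)

definition proper_action :: "('a::metric_space \<Rightarrow> 'a) set \<Rightarrow> bool" where
  "proper_action \<Gamma> \<longleftrightarrow> (\<forall>x. \<exists>r>0. finite {\<gamma> \<in> \<Gamma>. dist x (\<gamma> x) < r})"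

definition cocompact_action :: "('a::metric_space \<Rightarrow> 'a) set \<Rightarrow> bool" where
  "cocompact_action \<Gamma> \<longleftrightarrow> (\<exists>K. compact K \<and> (\<Union>\<gamma>\<in>\<Gamma>. \<gamma> ` K) = UNIV)"

definition finite_generating_set :: "('a, 'b) monoid_scheme \<Rightarrow> 'a set \<Rightarrow> bool" where
  "finite_generating_set G S \<longleftrightarrow> finite S \<and> S \<subseteq> carrier G \<and> generate G S = carrier G"

definition finitely_generated :: "('a, 'b) monoid_scheme \<Rightarrow> bool" where
  "finitely_generated G \<longleftrightarrow> (\<exists>S. finite_generating_set G S)"

definition word_norm :: "('a, 'b) monoid_scheme \<Rightarrow> 'a set \<Rightarrow> 'a \<Rightarrow> nat" where
  "word_norm G S g =
     (LEAST n. \<exists>w. length w = n \<and> set w \<subseteq> S \<union> m_inv G ` S \<and> foldr (\<otimes>\<^bsub>G\<^esub>) w \<one>\<^bsub>G\<^esub> = g)"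

definition equivalent_norms_on :: "'a set \<Rightarrow> ('a \<Rightarrow> real) \<Rightarrow> ('a \<Rightarrow> real) \<Rightarrow> bool" where
  "equivalent_norms_on H p q \<longleftrightarrow> (\<exists>c\<ge>1. \<forall>g\<in>H. (1 / c) * p g \<le> q g \<and> q g \<le> c * p g)"

text \<open>Finite generation of both groups is part of the definition, so that the quantification over
  generating sets is not vacuous. As word norms for different finite generating sets are
  equivalent, quantifying over all of them amounts to fixing one for each group.\<close>

definition straight :: "('a, 'b) monoid_scheme \<Rightarrow> 'a set \<Rightarrow> bool" where
  "straight G H \<longleftrightarrow>
     subgroup H G \<and> finitely_generated G \<and> finitely_generated (G\<lparr>carrier := H\<rparr>) \<and>
     (\<forall>S T. finite_generating_set G S \<longrightarrow> finite_generating_set (G\<lparr>carrier := H\<rparr>) T \<longrightarrow>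
        equivalent_norms_on H (\<lambda>g. real (word_norm (G\<lparr>carrier := H\<rparr>) T g))
          (\<lambda>g. real (word_norm G S g)))"

text \<open>A basis of a free abelian group can be taken inside the group, so basis sets over the
  element type cover every rank.\<close>

definition free_abelian :: "('a, 'b) monoid_scheme \<Rightarrow> bool" where
  "free_abelian G \<longleftrightarrow> (\<exists>B :: 'a set. G \<cong> free_Abelian_group B)"

end

theory Submission
  imports Defs "HOL-Analysis.Kronecker_Approximation_Theorem"
begin

text \<open>By the Ptolemy inequality, distance functions are midpoint-convex. If an isometry \<open>g\<close> attains its
  minimal displacement \<open>L\<close> at \<open>y\<close>, comparing \<open>L\<close> with the displacement of the midpoint of \<open>y\<close> and
  \<open>g y\<close> gives \<open>d(y, g\<^sup>2 y) = 2 L\<close>. So \<open>g y\<close> is a midpoint of \<open>y\<close> and \<open>g\<^sup>2 y\<close>, the sequence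
  \<open>n \<mapsto> d(y, g\<^sup>n y)\<close> is convex, and \<open>d(y, g\<^sup>n y) \<ge> n L\<close>. For a proper cocompact action the minimum is
  attained, is positive for elements of infinite order, and takes only finitely many values below 1.
  Hence the translation lengths of the nontrivial elements of a free abelian subgroup are bounded
  below by some \<open>\<epsilon> > 0\<close>. Dirichlet's simultaneous approximation turns this bound into a linear
  lower bound of the displacement of a base point by the \<open>\<ell>\<^sup>1\<close>-norm on \<open>\<int>\<^sup>n\<close>, and this displacement is
  at most linear in the word norm of the ambient group.\<close>

section \<open>Length functions and word norms\<close>

text \<open>A common frame for word norms and for the displacement of a base point. Nontrivial
  elements may have length zero, so displacements with fixed points qualify and pullbacks along
  homomorphisms stay inside the notion.\<close>

definition length_function :: "('a, 'b) monoid_scheme \<Rightarrow> ('a \<Rightarrow> real) \<Rightarrow> bool" where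
  "length_function G l \<longleftrightarrow>
     l \<one>\<^bsub>G\<^esub> = 0 \<and>
     (\<forall>g\<in>carrier G. l (inv\<^bsub>G\<^esub> g) = l g) \<and>
     (\<forall>g\<in>carrier G. \<forall>h\<in>carrier G. l (g \<otimes>\<^bsub>G\<^esub> h) \<le> l g + l h)"

context group
begin

lemma length_function_nonneg:
  assumes "length_function G l" "g \<in> carrier G"
  shows "0 \<le> l g"
proof -
  have "l (g \<otimes> inv g) \<le> l g + l (inv g)"
    using assms inv_closed unfolding length_function_def by blast
  then show ?thesis
    using assms by (simp add: length_function_def)
qed

lemma length_function_nat_pow_le:
  assumes "length_function G l" "g \<in> carrier G"
  shows "l (g [^] (n::nat)) \<le> real n * l g"
proof (induction n)
  case 0
  then show ?case
    using assms by (simp add: length_function_def)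
next
  case (Suc n)
  have "l (g [^] Suc n) \<le> l (g [^] n) + l g"
    using assms by (simp add: length_function_def)
  with Suc show ?case
    by (simp add: algebra_simps)
qed

lemma length_function_int_pow_le:
  assumes "length_function G l" "g \<in> carrier G"
  shows "l (g [^] (z::int)) \<le> \<bar>real_of_int z\<bar> * l g"
proof (cases z)
  case (nonneg n)
  then show ?thesis
    using length_function_nat_pow_le[OF assms, of n] by (simp add: int_pow_int)
next
  case (neg n)
  then have "l (g [^] z) = l (g [^] Suc n)"
    using assms int_pow_neg[OF assms(2), of "int (Suc n)"]
    unfolding length_function_def by (simp only: int_pow_int nat_pow_closed)
  then show ?thesis
    using length_function_nat_pow_le[OF assms, of "Suc n"] neg by (simp add: add.commute)
qed

lemma length_function_hom:
  assumes "group K" "f \<in> hom K G" "length_function G l"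
  shows "length_function K (l \<circ> f)"
proof -
  interpret f: group_hom K G f
    using assms by (simp add: group_hom_def group_hom_axioms_def is_group)
  show ?thesis
    using assms(3) by (simp add: length_function_def)
qed

section \<open>Words in generators and the word norm as a length function\<close>

lemma foldr_mult_closed: "set w \<subseteq> carrier G \<Longrightarrow> foldr (\<otimes>) w \<one> \<in> carrier G"
  by (induction w) auto

lemma foldr_mult_append:
  "set u \<subseteq> carrier G \<Longrightarrow> set v \<subseteq> carrier G \<Longrightarrow>
    foldr (\<otimes>) (u @ v) \<one> = foldr (\<otimes>) u \<one> \<otimes> foldr (\<otimes>) v \<one>"
  by (induction u) (simp_all add: foldr_mult_closed m_assoc del: foldr_append)

lemma foldr_mult_inv:
  "set w \<subseteq> carrier G \<Longrightarrow> foldr (\<otimes>) (rev (map (m_inv G) w)) \<one> = inv (foldr (\<otimes>) w \<one>)"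
proof (induction w)
  case (Cons x w)
  then have "set (rev (map (m_inv G) w)) \<subseteq> carrier G"
    by auto
  with Cons show ?case
    by (simp add: foldr_mult_append foldr_mult_closed inv_mult_group del: foldr_append)
qed simp

lemma letters_closed: "S \<subseteq> carrier G \<Longrightarrow> S \<union> m_inv G ` S \<subseteq> carrier G"
  by auto

lemma inv_letters:
  assumes "S \<subseteq> carrier G" "set w \<subseteq> S \<union> m_inv G ` S"
  shows "set (rev (map (m_inv G) w)) \<subseteq> S \<union> m_inv G ` S"
proof -
  have "m_inv G x \<in> S \<union> m_inv G ` S" if "x \<in> S \<union> m_inv G ` S" for x
    using that assms(1) by auto
  then have "m_inv G ` set w \<subseteq> S \<union> m_inv G ` S"
    using assms(2) by blast
  then show ?thesis
    by simp
qed

lemma generate_imp_word: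
  assumes "S \<subseteq> carrier G" "g \<in> generate G S"
  shows "\<exists>w. set w \<subseteq> S \<union> m_inv G ` S \<and> foldr (\<otimes>) w \<one> = g"
  using assms(2)
proof induction
  case one
  show ?case
    by (intro exI[of _ "[]"]) simp
next
  case (incl h)
  then show ?case
    using assms(1) by (intro exI[of _ "[h]"]) auto
next
  case (inv h)
  then show ?case
    using assms(1) by (intro exI[of _ "[m_inv G h]"]) auto
next
  case (eng h1 h2)
  then obtain u v where "set u \<subseteq> S \<union> m_inv G ` S" "foldr (\<otimes>) u \<one> = h1"
    "set v \<subseteq> S \<union> m_inv G ` S" "foldr (\<otimes>) v \<one> = h2"
    by blast
  moreover have "set u \<subseteq> carrier G" "set v \<subseteq> carrier G"
    using calculation letters_closed[OF assms(1)] by blast+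
  ultimately show ?case
    by (intro exI[of _ "u @ v"]) (simp add: foldr_mult_append del: foldr_append)
qed

lemma word_norm_le:
  "set w \<subseteq> S \<union> m_inv G ` S \<Longrightarrow> word_norm G S (foldr (\<otimes>) w \<one>) \<le> length w"
  unfolding word_norm_def by (rule Least_le) blast

text \<open>Because \<open>S\<close> generates, some word represents \<open>g\<close>, so the
  \<open>LEAST\<close> in \<open>word_norm\<close> is a genuine minimum.\<close>

lemma word_norm_attained:
  assumes "finite_generating_set G S" "g \<in> carrier G"
  obtains w where "set w \<subseteq> S \<union> m_inv G ` S" "foldr (\<otimes>) w \<one> = g" "length w = word_norm G S g"
proof -
  have "\<exists>n w. length w = n \<and> set w \<subseteq> S \<union> m_inv G ` S \<and> foldr (\<otimes>) w \<one> = g"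
    using generate_imp_word[of S g] assms by (auto simp: finite_generating_set_def)
  from LeastI_ex[OF this] show thesis
    using that unfolding word_norm_def by blast
qed

lemma word_norm_inv_le:
  assumes "finite_generating_set G S" "g \<in> carrier G"
  shows "word_norm G S (inv g) \<le> word_norm G S g"
proof -
  obtain w where w: "set w \<subseteq> S \<union> m_inv G ` S" "foldr (\<otimes>) w \<one> = g" "length w = word_norm G S g"
    by (rule word_norm_attained[OF assms])
  have S: "S \<subseteq> carrier G"
    using assms(1) by (simp add: finite_generating_set_def)
  then have "set w \<subseteq> carrier G"
    using w(1) letters_closed by blast
  from foldr_mult_inv[OF this] show ?thesis
    using word_norm_le[OF inv_letters[OF S w(1)]] w by simp
qed

text \<open>Shortest words are concatenated for subadditivity, and reversed with inverted letters
  for symmetry.\<close>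

lemma length_function_word_norm:
  assumes "finite_generating_set G S"
  shows "length_function G (\<lambda>g. real (word_norm G S g))"
  unfolding length_function_def
proof (intro conjI ballI)
  have S: "S \<union> m_inv G ` S \<subseteq> carrier G"
    using assms letters_closed by (simp add: finite_generating_set_def)
  show "real (word_norm G S \<one>) = 0"
    using word_norm_le[of "[]" S] by simp
  fix g assume g: "g \<in> carrier G"
  show "real (word_norm G S (inv g)) = real (word_norm G S g)"
    using word_norm_inv_le[OF assms g] word_norm_inv_le[OF assms inv_closed[OF g]] g by simp
  fix h assume h: "h \<in> carrier G"
  obtain u where u: "set u \<subseteq> S \<union> m_inv G ` S" "foldr (\<otimes>) u \<one> = g" "length u = word_norm G S g"
    by (rule word_norm_attained[OF assms g])
  obtain v where v: "set v \<subseteq> S \<union> m_inv G ` S" "foldr (\<otimes>) v \<one> = h" "length v = word_norm G S h"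
    by (rule word_norm_attained[OF assms h])
  have "foldr (\<otimes>) (u @ v) \<one> = g \<otimes> h"
    using foldr_mult_append[of u v] u v S by blast
  then show "real (word_norm G S (g \<otimes> h)) \<le> real (word_norm G S g) + real (word_norm G S h)"
    using word_norm_le[of "u @ v" S] u v by simp
qed

text \<open>Subadditivity along a shortest word, whose letters all have length at most
  \<open>c\<close>. It yields both easy estimates: the ambient word norm against that of the
  subgroup, and displacement against the ambient word norm.\<close>

lemma length_function_le_word_norm:
  assumes "finite_generating_set G S" "length_function G l"
  obtains c where "c \<ge> 0" "\<And>g. g \<in> carrier G \<Longrightarrow> l g \<le> c * real (word_norm G S g)"
proof -
  \<comment> \<open>A sum of nonnegative lengths dominates each of them and, unlike a maximum, also
    makes sense for empty \<open>S\<close>.\<close>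
  define c where "c = (\<Sum>s\<in>S. l s)"
  have S: "finite S" "S \<subseteq> carrier G"
    using assms(1) by (auto simp: finite_generating_set_def)
  have pos: "l s \<ge> 0" if "s \<in> S" for s
    using that S length_function_nonneg[OF assms(2)] by blast
  then have "c \<ge> 0"
    unfolding c_def by (rule sum_nonneg)
  have letter: "l s \<le> c" if "s \<in> S \<union> m_inv G ` S" for s
  proof -
    have "l t \<le> c" if "t \<in> S" for t
      unfolding c_def using S(1) pos that by (intro member_le_sum) auto
    then show ?thesis
      using that S(2) assms(2) by (auto simp: length_function_def)
  qed
  have word: "l (foldr (\<otimes>) w \<one>) \<le> c * real (length w)" if "set w \<subseteq> S \<union> m_inv G ` S" for w
    using that
  proof (induction w)
    case Nil
    then show ?case
      using assms(2) by (simp add: length_function_def)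
  next
    case (Cons s w)
    then have "s \<in> carrier G" "set w \<subseteq> carrier G"
      using letters_closed[OF S(2)] by auto
    then have "l (s \<otimes> foldr (\<otimes>) w \<one>) \<le> l s + l (foldr (\<otimes>) w \<one>)"
      using assms(2) foldr_mult_closed[of w] by (simp add: length_function_def)
    also have "\<dots> \<le> c + c * real (length w)"
      using Cons letter[of s] by auto
    finally show ?case
      by (simp add: algebra_simps)
  qed
  have "l g \<le> c * real (word_norm G S g)" if "g \<in> carrier G" for g
    using word_norm_attained[OF assms(1) that] word by metis
  with \<open>c \<ge> 0\<close> show thesis
    by (rule that)
qed

end

section \<open>Free abelian groups of finite rank\<close>

text \<open>The images of finitely many generators involve only finitely many basis elements, hence
  so does every image. As each \<open>frag_of b\<close> is an image, no further basis elements
  exist.\<close>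

lemma fg_free_abelian_basis:
  fixes G :: "('a, 'b) monoid_scheme"
  assumes "group G" "finitely_generated G" "free_abelian G"
  obtains B :: "'a set" and f where "finite B" "f \<in> iso G (free_Abelian_group B)"
proof -
  obtain B :: "'a set" and f where f: "f \<in> iso G (free_Abelian_group B)"
    using assms(3) by (auto simp: free_abelian_def is_iso_def)
  obtain T where T: "finite T" "T \<subseteq> carrier G" "generate G T = carrier G"
    using assms(2) by (auto simp: finitely_generated_def finite_generating_set_def)
  interpret f: group_hom G "free_Abelian_group B" f
    using f assms(1) by (simp add: group_hom_def group_hom_axioms_def iso_def)
  have f_in: "Poly_Mapping.keys (f g) \<subseteq> B" if "g \<in> carrier G" for g
    using f.hom_closed[OF that] by simp
  define B' where "B' = (\<Union>t\<in>T. Poly_Mapping.keys (f t))"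
  have keys: "Poly_Mapping.keys (f g) \<subseteq> B'" if "g \<in> generate G T" for g
    using that
  proof induction
    case one
    then show ?case by simp
  next
    case (incl h)
    then show ?case by (auto simp: B'_def)
  next
    case (inv h)
    then have "h \<in> carrier G"
      using T by blast
    then show ?case
      using inv f_in by (auto simp: B'_def)
  next
    case (eng h1 h2)
    then have "h1 \<in> carrier G" "h2 \<in> carrier G"
      using T by auto
    then show ?case
      using eng keys_add[of "f h1" "f h2"] by auto
  qed
  have "B \<subseteq> B'"
  proof
    fix b assume "b \<in> B"
    then have "frag_of b \<in> f ` carrier G"
      using f by (auto simp: iso_def bij_betw_def)
    then obtain g where "g \<in> carrier G" "f g = frag_of b"
      by auto
    then show "b \<in> B'"
      using keys[of g] T(3) by simp
  qed
  moreover have "finite B'"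
    using T(1) by (simp add: B'_def)
  ultimately have "finite B"
    by (rule finite_subset)
  with f show thesis
    by (rule that[rotated])
qed

text \<open>Expand \<open>v\<close> in the basis and apply subadditivity, first to the sum and then
  to the multiples of each basis element.\<close>

lemma length_function_free_abelian_le:
  assumes "finite B" "length_function (free_Abelian_group B) l" "Poly_Mapping.keys v \<subseteq> B"
  shows "l v \<le> (\<Sum>b\<in>B. \<bar>real_of_int (Poly_Mapping.lookup v b)\<bar> * l (frag_of b))"
proof -
  interpret F: group "free_Abelian_group B"
    by simp
  have l0: "l 0 = 0"
    and ladd: "\<And>x y. Poly_Mapping.keys x \<subseteq> B \<Longrightarrow> Poly_Mapping.keys y \<subseteq> B \<Longrightarrow> l (x + y) \<le> l x + l y"
    using assms(2) by (auto simp: length_function_def)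
  let ?m = "\<lambda>b. frag_cmul (Poly_Mapping.lookup v b) (frag_of b)"
  have m: "Poly_Mapping.keys (?m b) \<subseteq> {b}" for b
    using keys_cmul[of _ "frag_of b"] by auto
  have sum_le: "Poly_Mapping.keys (\<Sum>b\<in>A. ?m b) \<subseteq> B \<and> l (\<Sum>b\<in>A. ?m b) \<le> (\<Sum>b\<in>A. l (?m b))"
    if "finite A" "A \<subseteq> B" for A
    using that
  proof (induction A rule: finite_induct)
    case (insert a A)
    then have "Poly_Mapping.keys (?m a) \<subseteq> B"
      using m[of a] by blast
    then show ?case
      using insert ladd[of "?m a" "\<Sum>b\<in>A. ?m b"] keys_add[of "?m a" "\<Sum>b\<in>A. ?m b"] by auto
  qed (simp add: l0)
  have expansion: "(\<Sum>b\<in>B. ?m b) = v"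
  proof (rule poly_mapping_eqI)
    fix x
    have "Poly_Mapping.lookup (\<Sum>b\<in>B. ?m b) x = (\<Sum>b\<in>B. if b = x then Poly_Mapping.lookup v x else 0)"
      unfolding lookup_sum by (intro sum.cong) auto
    also have "\<dots> = Poly_Mapping.lookup v x"
      using assms(1,3) by (auto simp: in_keys_iff)
    finally show "Poly_Mapping.lookup (\<Sum>b\<in>B. ?m b) x = Poly_Mapping.lookup v x" .
  qed
  have "l v = l (\<Sum>b\<in>B. ?m b)"
    by (simp only: expansion)
  also have "\<dots> \<le> (\<Sum>b\<in>B. l (?m b))"
    using sum_le[OF assms(1) order_refl] by blast
  also have "\<dots> \<le> (\<Sum>b\<in>B. \<bar>real_of_int (Poly_Mapping.lookup v b)\<bar> * l (frag_of b))"
  proof (rule sum_mono)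
    fix b assume "b \<in> B"
    then show "l (?m b) \<le> \<bar>real_of_int (Poly_Mapping.lookup v b)\<bar> * l (frag_of b)"
      using F.length_function_int_pow_le[OF assms(2), of "frag_of b" "Poly_Mapping.lookup v b"] by simp
  qed
  finally show ?thesis .
qed

text \<open>Dividing by \<open>k\<close> and letting \<open>k\<close> grow removes the additive
  error \<open>C\<close>.\<close>

lemma le_of_nat_multiples:
  fixes a b C :: real
  assumes "\<And>k::nat. real k * a \<le> real k * b + C"
  shows "a \<le> b"
proof (rule ccontr)
  assume "\<not> a \<le> b"
  then obtain k :: nat where "C < real k * (a - b)"
    using reals_Archimedean3[of "a - b"] by auto
  with assms[of k] show False
    by (simp add: algebra_simps)
qed

text \<open>Write \<open>M\<close> for the sup norm of \<open>u\<close>. Dirichlet's theorem gives a nonzero \<open>w\<close> and a bounded \<open>q > 0\<close> such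
  that \<open>M w = q u + r\<close> with \<open>r\<close> small compared to \<open>M\<close>. Evaluating \<open>l\<close> on the multiples of both sides
  yields \<open>M \<epsilon> \<le> q l(u) + l(r)\<close>, where \<open>l(r) \<le> M \<epsilon> / 2\<close>.\<close>

lemma length_function_free_abelian_ge:
  fixes l :: "('b \<Rightarrow>\<^sub>0 int) \<Rightarrow> real"
  assumes "finite B" "length_function (free_Abelian_group B) l" "\<epsilon> > 0"
    and growth: "\<And>w. Poly_Mapping.keys w \<subseteq> B \<Longrightarrow> w \<noteq> 0 \<Longrightarrow>
      \<exists>C. \<forall>k::nat. real k * \<epsilon> \<le> l (frag_cmul (int k) w) + C"
  obtains c where "c > 0"
    "\<And>u. Poly_Mapping.keys u \<subseteq> B \<Longrightarrow> c * (\<Sum>b\<in>B. \<bar>real_of_int (Poly_Mapping.lookup u b)\<bar>) \<le> l u"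
proof -
  interpret F: group "free_Abelian_group B"
    by simp
  have l0: "l 0 = 0"
    and ladd: "\<And>x y. Poly_Mapping.keys x \<subseteq> B \<Longrightarrow> Poly_Mapping.keys y \<subseteq> B \<Longrightarrow> l (x + y) \<le> l x + l y"
    using assms(2) by (auto simp: length_function_def)
  have lpos: "0 \<le> l x" if "Poly_Mapping.keys x \<subseteq> B" for x
    using F.length_function_nonneg[OF assms(2), of x] that by simp
  have lmul: "l (frag_cmul (int k) x) \<le> real k * l x" if "Poly_Mapping.keys x \<subseteq> B" for k x
    using F.length_function_nat_pow_le[OF assms(2), of x k] that by simp
  have keys_mul: "Poly_Mapping.keys (frag_cmul z x) \<subseteq> B" if "Poly_Mapping.keys x \<subseteq> B" for z x
    using keys_cmul[of z x] that by blast
  define n where "n = card B"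
  \<comment> \<open>Dirichlet's theorem is indexed by the numbers below \<open>n\<close>, so the
    basis is enumerated; \<open>\<tau>\<close> is the inverse enumeration.\<close>
  obtain \<sigma> where \<sigma>: "bij_betw \<sigma> {..<n} B"
    using ex_bij_betw_nat_finite[OF assms(1)] by (auto simp: n_def atLeast0LessThan)
  define \<tau> where "\<tau> = the_inv_into {..<n} \<sigma>"
  have \<tau>: "\<tau> b < n" "\<sigma> (\<tau> b) = b" if "b \<in> B" for b
    using that the_inv_into_into[of \<sigma> "{..<n}" b "{..<n}"] f_the_inv_into_f_bij_betw[OF \<sigma>, of b] \<sigma>
    by (auto simp: \<tau>_def bij_betw_def)
  define C\<^sub>0 where "C\<^sub>0 = (\<Sum>b\<in>B. l (frag_of b))"
  have "C\<^sub>0 \<ge> 0"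
    unfolding C\<^sub>0_def by (rule sum_nonneg) (use lpos in auto)
  \<comment> \<open>The precision \<open>P\<close> is chosen so that a remainder with coefficients
    of size at most \<open>M / P\<close> has length at most
    \<open>M * \<epsilon> / 2\<close>.\<close>
  obtain P :: nat where P: "P > 0" "C\<^sub>0 / real P \<le> \<epsilon> / 2"
  proof -
    obtain P :: nat where "2 * C\<^sub>0 / \<epsilon> < real P"
      using reals_Archimedean2 by blast
    moreover from this have "P > 0"
      using \<open>C\<^sub>0 \<ge> 0\<close> \<open>\<epsilon> > 0\<close> by (smt (verit) divide_nonneg_nonneg of_nat_0_less_iff)
    ultimately show thesis
      using \<open>\<epsilon> > 0\<close> by (intro that[of P]) (auto simp: field_simps)
  qed
  \<comment> \<open>Dirichlet's bound on the denominator \<open>q\<close>; it does not depend on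
    \<open>u\<close>, which makes the final constant uniform.\<close>
  define Q where "Q = real (P ^ n)"
  have "Q > 0"
    using P by (simp add: Q_def)
  have sup_le: "real_of_int M * (\<epsilon> / 2) \<le> Q * l u"
    if u: "Poly_Mapping.keys u \<subseteq> B" and M: "M > 0" "\<And>b. b \<in> B \<Longrightarrow> \<bar>Poly_Mapping.lookup u b\<bar> \<le> M"
      "a \<in> B" "\<bar>Poly_Mapping.lookup u a\<bar> = M" for u M a
  proof -
    obtain q p where q: "0 < q" "q \<le> int (P ^ n)"
      and p: "\<And>i. i < n \<Longrightarrow>
        \<bar>of_int q * (of_int (Poly_Mapping.lookup u (\<sigma> i)) / of_int M) - of_int (p i)\<bar> < 1 / real P"
      using Dirichlet_approx_simult[OF P(1), of n "\<lambda>i. of_int (Poly_Mapping.lookup u (\<sigma> i)) / of_int M"]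
      by blast
    define w where "w = (\<Sum>b\<in>B. frag_cmul (p (\<tau> b)) (frag_of b))"
    have w_lookup: "Poly_Mapping.lookup w x = (if x \<in> B then p (\<tau> x) else 0)" for x
    proof -
      have "Poly_Mapping.lookup w x = (\<Sum>b\<in>B. if b = x then p (\<tau> x) else 0)"
        unfolding w_def lookup_sum by (intro sum.cong) auto
      then show ?thesis
        using assms(1) by auto
    qed
    have w_keys: "Poly_Mapping.keys w \<subseteq> B"
    proof
      fix x assume "x \<in> Poly_Mapping.keys w"
      then show "x \<in> B"
        by (rule contrapos_pp) (simp add: in_keys_iff w_lookup)
    qed
    have p': "\<bar>of_int q * (of_int (Poly_Mapping.lookup u b) / of_int M) - of_int (p (\<tau> b))\<bar> < 1 / real P"
      if "b \<in> B" for b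
      using p[of "\<tau> b"] \<tau>[OF that] by simp
    \<comment> \<open>At the coordinate \<open>a\<close> the approximated ratio is 1 or -1. If its
      numerator \<open>p (\<tau> a)\<close> were 0, the approximation would force
      \<open>q < 1 / P\<close>, impossible for a positive integer \<open>q\<close>.\<close>
    have "w \<noteq> 0"
    proof
      assume "w = 0"
      then have "p (\<tau> a) = 0"
        using w_lookup[of a] \<open>a \<in> B\<close> by simp
      then have "\<bar>of_int q * (of_int (Poly_Mapping.lookup u a) / of_int M)\<bar> < 1 / real P"
        using p'[OF \<open>a \<in> B\<close>] by simp
      moreover have "\<bar>of_int (Poly_Mapping.lookup u a) / of_int M\<bar> = (1::real)"
        using M(1) M(4) by (simp flip: of_int_abs)
      ultimately have "of_int q < 1 / real P"
        using q by (simp only: abs_mult)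
      moreover have "1 / real P \<le> 1"
        using P by simp
      ultimately show False
        using q by linarith
    qed
    define r where "r = frag_cmul M w - frag_cmul q u"
    have r_keys: "Poly_Mapping.keys r \<subseteq> B"
      using keys_diff[of "frag_cmul M w" "frag_cmul q u"] keys_mul[OF w_keys, of M] keys_mul[OF u, of q]
      unfolding r_def by blast
    have r_lookup: "\<bar>real_of_int (Poly_Mapping.lookup r b)\<bar> \<le> of_int M / real P" if "b \<in> B" for b
    proof -
      have "real_of_int (Poly_Mapping.lookup r b) =
          - of_int M * (of_int q * (of_int (Poly_Mapping.lookup u b) / of_int M) - of_int (p (\<tau> b)))"
        using that M(1) by (simp add: r_def lookup_minus w_lookup field_simps)
      then have "\<bar>real_of_int (Poly_Mapping.lookup r b)\<bar> =
          of_int M * \<bar>of_int q * (of_int (Poly_Mapping.lookup u b) / of_int M) - of_int (p (\<tau> b))\<bar>"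
        using M(1) by (simp only: abs_mult)
      also have "\<dots> \<le> of_int M * (1 / real P)"
        using p'[OF that] M(1) by (intro mult_left_mono) auto
      finally show ?thesis by simp
    qed
    have "l r \<le> (\<Sum>b\<in>B. \<bar>real_of_int (Poly_Mapping.lookup r b)\<bar> * l (frag_of b))"
      by (rule length_function_free_abelian_le[OF assms(1,2) r_keys])
    also have "\<dots> \<le> (\<Sum>b\<in>B. of_int M / real P * l (frag_of b))"
      using r_lookup lpos by (intro sum_mono mult_right_mono) auto
    also have "\<dots> = of_int M * (C\<^sub>0 / real P)"
      by (simp add: C\<^sub>0_def sum_distrib_left sum_divide_distrib)
    also have "\<dots> \<le> of_int M * (\<epsilon> / 2)"
      using P M(1) by (intro mult_left_mono) auto
    finally have l_r: "l r \<le> of_int M * (\<epsilon> / 2)" .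
    obtain C where C: "\<And>k::nat. real k * \<epsilon> \<le> l (frag_cmul (int k) w) + C"
      using growth[OF w_keys \<open>w \<noteq> 0\<close>] by blast
    have "of_int M * \<epsilon> \<le> of_int q * l u + l r"
    proof (rule le_of_nat_multiples)
      fix k :: nat
      have "real k * (of_int M * \<epsilon>) = real (k * nat M) * \<epsilon>"
        using M(1) by simp
      also have "\<dots> \<le> l (frag_cmul (int (k * nat M)) w) + C"
        by (rule C)
      also have "frag_cmul (int (k * nat M)) w = frag_cmul (int (k * nat q)) u + frag_cmul (int k) r"
        using M(1) q(1) by (intro poly_mapping_eqI) (simp add: r_def lookup_add lookup_minus algebra_simps)
      also have "l \<dots> \<le> l (frag_cmul (int (k * nat q)) u) + l (frag_cmul (int k) r)"
        using u r_keys by (intro ladd keys_mul)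
      also have "\<dots> \<le> real (k * nat q) * l u + real k * l r"
        using u r_keys by (intro add_mono lmul)
      finally show "real k * (of_int M * \<epsilon>) \<le> real k * (of_int q * l u + l r) + C"
        using q(1) by (simp add: algebra_simps)
    qed
    then have "of_int M * (\<epsilon> / 2) \<le> of_int q * l u"
      using l_r by simp
    also have "of_int q \<le> Q"
      using q(2) unfolding Q_def by (metis of_int_le_iff of_int_of_nat_eq)
    then have "of_int q * l u \<le> Q * l u"
      using lpos[OF u] by (intro mult_right_mono)
    finally show ?thesis .
  qed
  \<comment> \<open>Passing from the sup norm to the sum of absolute values costs a factor
    \<open>n\<close>; the extra 1 keeps the denominator positive for an empty basis.\<close>
  define c where "c = \<epsilon> / (2 * Q * (real n + 1))"
  have "c > 0"
    using \<open>\<epsilon> > 0\<close> \<open>Q > 0\<close> by (simp add: c_def)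
  moreover have "c * (\<Sum>b\<in>B. \<bar>real_of_int (Poly_Mapping.lookup u b)\<bar>) \<le> l u"
    if u: "Poly_Mapping.keys u \<subseteq> B" for u
  proof (cases "u = 0")
    case True
    then show ?thesis
      by (simp add: l0)
  next
    case False
    then obtain a\<^sub>0 where a\<^sub>0: "a\<^sub>0 \<in> Poly_Mapping.keys u"
      by (metis keys_eq_empty equals0I)
    define M where "M = Max ((\<lambda>b. \<bar>Poly_Mapping.lookup u b\<bar>) ` B)"
    have le_M: "\<bar>Poly_Mapping.lookup u b\<bar> \<le> M" if "b \<in> B" for b
      unfolding M_def using assms(1) that by (intro Max_ge) auto
    have "M \<in> (\<lambda>b. \<bar>Poly_Mapping.lookup u b\<bar>) ` B"
      unfolding M_def using assms(1) a\<^sub>0 u by (intro Max_in) auto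
    then obtain a where a: "a \<in> B" "\<bar>Poly_Mapping.lookup u a\<bar> = M"
      by auto
    have "\<bar>Poly_Mapping.lookup u a\<^sub>0\<bar> > 0"
      using a\<^sub>0 by (simp add: in_keys_iff)
    then have "M > 0"
      using le_M[of a\<^sub>0] a\<^sub>0 u by auto
    have "(\<Sum>b\<in>B. \<bar>real_of_int (Poly_Mapping.lookup u b)\<bar>) \<le> (\<Sum>b\<in>B. real_of_int M)"
      using le_M by (intro sum_mono) (simp flip: of_int_abs)
    also have "\<dots> \<le> (real n + 1) * of_int M"
      using \<open>M > 0\<close> by (simp add: n_def algebra_simps)
    finally have "c * (\<Sum>b\<in>B. \<bar>real_of_int (Poly_Mapping.lookup u b)\<bar>) \<le> c * ((real n + 1) * of_int M)"
      using \<open>c > 0\<close> by (intro mult_left_mono) auto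
    also have "\<dots> = (of_int M * (\<epsilon> / 2)) / Q"
      using \<open>Q > 0\<close> by (simp add: c_def divide_simps)
    also have "\<dots> \<le> l u"
      using sup_le[OF u \<open>M > 0\<close> le_M a] \<open>Q > 0\<close> by (simp add: field_simps)
    finally show ?thesis .
  qed
  ultimately show thesis
    by (rule that)
qed

section \<open>Isometries of geodesic Ptolemy spaces\<close>

lemma iso_group_simps [simp]:
  "f \<otimes>\<^bsub>iso_group\<^esub> g = f \<circ> g" "\<one>\<^bsub>iso_group\<^esub> = id"
  "f \<in> carrier iso_group \<longleftrightarrow> bij f \<and> (\<forall>x y. dist (f x) (f y) = dist x y)"
  by (simp_all add: iso_group_def)

text \<open>Applying the inverse isometry to \<open>x\<close> and \<open>g x\<close> gives symmetry.
  The triangle inequality through \<open>g x\<close> gives subadditivity, since \<open>g\<close>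
  preserves the second distance.\<close>

lemma length_function_displacement:
  "length_function iso_group (\<lambda>g. dist x (g x))"
proof -
  interpret group iso_group
    by (rule group_iso_group)
  show ?thesis
    unfolding length_function_def
  proof (intro conjI ballI)
    fix g :: "'a \<Rightarrow> 'a" assume g: "g \<in> carrier iso_group"
    have "dist x (g x) = dist ((inv\<^bsub>iso_group\<^esub> g) x) ((inv\<^bsub>iso_group\<^esub> g) (g x))"
      using inv_closed[OF g] by (simp del: inv_closed)
    also have "(inv\<^bsub>iso_group\<^esub> g) (g x) = x"
      using l_inv[OF g] by (simp add: fun_eq_iff del: l_inv)
    finally show "dist x ((inv\<^bsub>iso_group\<^esub> g) x) = dist x (g x)"
      by (simp add: dist_commute)
    fix h :: "'a \<Rightarrow> 'a"
    have "dist x (g (h x)) \<le> dist x (g x) + dist (g x) (g (h x))"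
      by (rule dist_triangle)
    then show "dist x ((g \<otimes>\<^bsub>iso_group\<^esub> h) x) \<le> dist x (g x) + dist x (h x)"
      using g by simp
  qed simp
qed

text \<open>Geodesics have constant speed, so it suffices to divide the parameter interval. The
  ratio 1/2 supplies midpoints; other ratios serve to factor elements of
  \<open>near\<close>.\<close>

lemma geodesic_division:
  assumes "geodesic_space (UNIV :: 'a::metric_space set)" "0 \<le> t" "t \<le> 1"
  obtains z where "dist p z = t * dist p q" "dist z q = (1 - t) * dist p (q::'a)"
proof -
  obtain c a b l where "a \<le> b" "c a = p" "c b = q" "l \<ge> 0"
    and l: "\<And>s t. s \<in> {a..b} \<Longrightarrow> t \<in> {a..b} \<Longrightarrow> dist (c t) (c s) = l * \<bar>t - s\<bar>"
    using assms(1) unfolding geodesic_space_def geodesic_from_to_def by (metis UNIV_I)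
  have "a + t * (b - a) \<in> {a..b}"
    using assms(2,3) \<open>a \<le> b\<close> mult_left_le_one_le[of "b - a" t] by auto
  moreover have "dist p q = l * (b - a)"
    using l[of b a] \<open>a \<le> b\<close> \<open>c a = p\<close> \<open>c b = q\<close> by simp
  moreover have "\<bar>a - (a + t * (b - a))\<bar> = t * (b - a)" "\<bar>(a + t * (b - a)) - b\<bar> = (1 - t) * (b - a)"
    using calculation(1) by (auto simp: algebra_simps)
  ultimately show thesis
    using that[of "c (a + t * (b - a))"] l[of "a + t * (b - a)" a] l[of b "a + t * (b - a)"] \<open>a \<le> b\<close> \<open>c a = p\<close> \<open>c b = q\<close>
    by simp
qed

text \<open>The Ptolemy inequality for the pairs \<open>p, m\<close> and \<open>x, y\<close>,
  divided by \<open>dist x y\<close>. For \<open>x = y\<close> the point \<open>m\<close> coincides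
  with \<open>x\<close>.\<close>

lemma ptolemy_midpoint:
  assumes "ptolemy (UNIV :: 'a::metric_space set)"
    and "dist x m = dist x y / 2" "dist m y = dist x y / 2"
  shows "dist p m \<le> (dist p x + dist p (y::'a)) / 2"
proof (cases "x = y")
  case True
  then show ?thesis
    using assms(2) by simp
next
  case False
  have "dist p m * dist x y \<le> dist p x * dist m y + dist p y * dist m x"
    using assms(1) unfolding ptolemy_def by blast
  then have "dist p m * dist x y \<le> (dist p x + dist p y) / 2 * dist x y"
    using assms(2,3) by (simp add: dist_commute[of m x] algebra_simps)
  with False show ?thesis
    by (simp add: mult_le_cancel_right)
qed

lemma displacement_minimizer_growth:
  fixes g :: "'a::metric_space \<Rightarrow> 'a"
  assumes geo: "geodesic_space (UNIV :: 'a set)" and ptol: "ptolemy (UNIV :: 'a set)"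
    and iso: "\<And>x y. dist (g x) (g y) = dist x y"
    and min: "\<And>z. dist y (g y) \<le> dist z (g z)"
  shows "real n * dist y (g y) \<le> dist y ((g ^^ n) y)"
proof -
  let ?L = "dist y (g y)"
  have iso_pow: "dist ((g ^^ n) x) ((g ^^ n) y) = dist x y" for n x y
    by (induction n) (simp_all add: iso)
  obtain m where m: "dist y m = ?L / 2" "dist m (g y) = ?L / 2"
    using geodesic_division[OF geo, of "1/2" y "g y"] by auto
  have gm: "dist (g y) (g m) = dist (g y) (g (g y)) / 2" "dist (g m) (g (g y)) = dist (g y) (g (g y)) / 2"
    using m by (simp_all add: iso)
  \<comment> \<open>Since \<open>g m\<close> is a midpoint of \<open>g y\<close> and
    \<open>g (g y)\<close>, convexity as seen from \<open>m\<close> bounds \<open>?L\<close> by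
    \<open>?L / 4 + dist m (g (g y)) / 2\<close>. Convexity as seen from \<open>g (g y)\<close>
    bounds the last distance in turn, and together they give
    \<open>dist y (g (g y)) \<ge> 2 * ?L\<close>.\<close>
  have "?L \<le> dist m (g m)"
    by (rule min)
  also have "\<dots> \<le> (dist m (g y) + dist m (g (g y))) / 2"
    by (rule ptolemy_midpoint[OF ptol gm])
  finally have "?L \<le> (dist m (g y) + dist m (g (g y))) / 2" .
  moreover have "dist (g (g y)) m \<le> (dist (g (g y)) y + dist (g (g y)) (g y)) / 2"
    using m by (intro ptolemy_midpoint[OF ptol]) auto
  moreover have "dist (g (g y)) (g y) = ?L"
    by (simp add: iso dist_commute)
  ultimately have two: "dist y (g (g y)) \<ge> 2 * ?L"
    using m by (simp add: dist_commute)
  have "dist y (g (g y)) \<le> 2 * ?L"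
    using dist_triangle[of y "g (g y)" "g y"] by (simp add: iso)
  with two have two: "dist y (g (g y)) = 2 * ?L"
    by simp
  define f where "f n = dist y ((g ^^ n) y)" for n
  have convex: "f (Suc n) \<le> (f n + f (Suc (Suc n))) / 2" for n
  proof -
    have "dist ((g ^^ n) y) ((g ^^ Suc n) y) = dist y (g y)"
      "dist ((g ^^ Suc n) y) ((g ^^ Suc (Suc n)) y) = dist y (g y)"
      "dist ((g ^^ n) y) ((g ^^ Suc (Suc n)) y) = 2 * dist y (g y)"
      using iso_pow[of n y "g y"] iso_pow[of "Suc n" y "g y"] iso_pow[of n y "g (g y)"] two
      by (simp_all add: funpow_swap1)
    then show ?thesis
      unfolding f_def by (intro ptolemy_midpoint[OF ptol]) auto
  qed
  \<comment> \<open>Convexity makes the increments of \<open>f\<close> nondecreasing, and the first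
    one equals \<open>?L\<close>; the bound on increments must be carried along in the
    induction.\<close>
  have "f (Suc n) \<ge> f n + ?L \<and> f n \<ge> real n * ?L"
  proof (induction n)
    case 0
    then show ?case by (simp add: f_def)
  next
    case (Suc n)
    with convex[of n] show ?case
      by (simp add: algebra_simps)
  qed
  then show ?thesis
    by (simp add: f_def)
qed

section \<open>Proper cocompact actions\<close>

abbreviation iso_inv :: "('a::metric_space \<Rightarrow> 'a) \<Rightarrow> 'a \<Rightarrow> 'a" where
  "iso_inv \<equiv> m_inv iso_group"

locale ptolemy_action =
  fixes \<Gamma> :: "('a::metric_space \<Rightarrow> 'a) set"
  assumes geodesic: "geodesic_space (UNIV :: 'a set)"
    and ptolemy: "ptolemy (UNIV :: 'a set)"
    and subgroup: "subgroup \<Gamma> iso_group"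
    and proper: "proper_action \<Gamma>"
    and cocompact: "cocompact_action \<Gamma>"
begin

lemma isometry: "g \<in> \<Gamma> \<Longrightarrow> dist (g x) (g y) = dist x y"
  using subgroup.subset[OF subgroup] by auto

lemma comp_closed: "g \<in> \<Gamma> \<Longrightarrow> h \<in> \<Gamma> \<Longrightarrow> g \<circ> h \<in> \<Gamma>"
  using subgroup.m_closed[OF subgroup] by fastforce

lemma id_closed: "id \<in> \<Gamma>"
  using subgroup.one_closed[OF subgroup] by simp

lemma inv_closed: "g \<in> \<Gamma> \<Longrightarrow> iso_inv g \<in> \<Gamma>"
  by (rule subgroup.m_inv_closed[OF subgroup])

lemma inv_apply [simp]:
  assumes "g \<in> \<Gamma>"
  shows "iso_inv g (g x) = x" "g (iso_inv g x) = x"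
proof -
  have "g \<in> carrier iso_group"
    using assms subgroup.subset[OF subgroup] by blast
  from group.l_inv[OF group_iso_group this] group.r_inv[OF group_iso_group this]
  show "iso_inv g (g x) = x" "g (iso_inv g x) = x"
    by (simp_all add: fun_eq_iff)
qed

lemma dist_inv: "g \<in> \<Gamma> \<Longrightarrow> dist (iso_inv g x) y = dist x (g y)"
  using isometry[of g "iso_inv g x" y] by simp

section \<open>A compact set with covering translates, and finiteness of the elements moving it a
  bounded distance\<close>

definition K :: "'a set" where
  "K = (SOME K. compact K \<and> (\<Union>\<gamma>\<in>\<Gamma>. \<gamma> ` K) = UNIV)"

lemma compact_K: "compact K" and K_translates: "(\<Union>\<gamma>\<in>\<Gamma>. \<gamma> ` K) = UNIV"
  using cocompact someI_ex[of "\<lambda>K. compact K \<and> (\<Union>\<gamma>\<in>\<Gamma>. \<gamma> ` K) = UNIV"]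
  by (auto simp: cocompact_action_def K_def)

lemma translate_into_K:
  obtains \<gamma> k where "\<gamma> \<in> \<Gamma>" "k \<in> K" "x = \<gamma> k"
proof -
  have "x \<in> (\<Union>\<gamma>\<in>\<Gamma>. \<gamma> ` K)"
    by (simp add: K_translates)
  then show thesis
    using that by blast
qed

lemma K_nonempty: "K \<noteq> {}"
  using translate_into_K by blast

text \<open>Properness provides a radius at each point. Finitely many balls of a third of these
  radii cover \<open>K\<close>, and the displacement of \<open>y\<close> controls that of a nearby
  centre \<open>x\<close> up to \<open>2 * dist x y\<close>.\<close>

lemma uniformly_proper:
  obtains r where "r > 0" "\<And>y. y \<in> K \<Longrightarrow> finite {\<gamma> \<in> \<Gamma>. dist y (\<gamma> y) < r}"
proof -
  obtain r where r: "\<And>x. r x > 0" "\<And>x. finite {\<gamma> \<in> \<Gamma>. dist x (\<gamma> x) < r x}"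
    using choice[OF proper[unfolded proper_action_def]] by blast
  have cover: "K \<subseteq> (\<Union>x\<in>K. ball x (r x / 3))"
    using r(1) by (intro subsetI UN_I) auto
  obtain D where D: "D \<subseteq> K" "finite D" "K \<subseteq> (\<Union>x\<in>D. ball x (r x / 3))"
    by (rule compactE_image[OF compact_K _ cover]) auto
  have "D \<noteq> {}"
    using K_nonempty D(3) by auto
  define \<rho> where "\<rho> = Min ((\<lambda>x. r x / 3) ` D)"
  have "\<rho> > 0"
    using D(2) \<open>D \<noteq> {}\<close> r(1) by (simp add: \<rho>_def)
  moreover have "finite {\<gamma> \<in> \<Gamma>. dist y (\<gamma> y) < \<rho>}" if y: "y \<in> K" for y
  proof -
    obtain x where x: "x \<in> D" "dist x y < r x / 3"
      using y D(3) by auto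
    have "\<rho> \<le> r x / 3"
      unfolding \<rho>_def using x D(2) by (intro Min_le) auto
    have "dist x (\<gamma> x) < r x" if "\<gamma> \<in> \<Gamma>" "dist y (\<gamma> y) < \<rho>" for \<gamma>
    proof -
      have "dist x (\<gamma> x) \<le> dist x y + dist y (\<gamma> y) + dist (\<gamma> y) (\<gamma> x)"
        using dist_triangle[of x "\<gamma> x" y] dist_triangle[of y "\<gamma> x" "\<gamma> y"] by simp
      also have "dist (\<gamma> y) (\<gamma> x) = dist x y"
        using isometry[OF that(1)] by (simp add: dist_commute)
      finally show ?thesis
        using x that \<open>\<rho> \<le> r x / 3\<close> by simp
    qed
    then show ?thesis
      by (intro finite_subset[OF _ r(2)[of x]]) auto
  qed
  ultimately show thesis
    by (rule that)
qed

text \<open>The sets of the Milnor-Svarc argument, with the compact set \<open>K\<close> in place of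
  a ball.\<close>

definition near :: "real \<Rightarrow> ('a \<Rightarrow> 'a) set" where
  "near r = {s \<in> \<Gamma>. \<exists>k\<in>K. \<exists>k'\<in>K. dist k (s k') < r}"

text \<open>Approximating the two points of \<open>K\<close> by centres from a finite set
  \<open>D\<close> leaves finitely many pairs of centres, so it is enough to count the elements that
  move one given centre close to another.\<close>

lemma finite_near_small:
  obtains \<delta> where "\<delta> > 0" "finite (near \<delta>)"
proof -
  obtain r where r: "r > 0" "\<And>y. y \<in> K \<Longrightarrow> finite {\<gamma> \<in> \<Gamma>. dist y (\<gamma> y) < r}"
    by (rule uniformly_proper) blast
  have cover: "K \<subseteq> (\<Union>x\<in>K. ball x (r / 6))"
    using r(1) by (intro subsetI UN_I) auto
  obtain D where D: "D \<subseteq> K" "finite D" "K \<subseteq> (\<Union>x\<in>D. ball x (r / 6))"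
    by (rule compactE_image[OF compact_K _ cover]) auto
  have fin: "finite {s \<in> \<Gamma>. dist x (s y) < r / 2}" (is "finite ?A") if "y \<in> D" for x y
  proof (cases "?A = {}")
    case False
    then obtain s\<^sub>0 where s\<^sub>0: "s\<^sub>0 \<in> \<Gamma>" "dist x (s\<^sub>0 y) < r / 2"
      by blast
    \<comment> \<open>Any two elements of \<open>?A\<close> differ by an element displacing
      \<open>y\<close> by less than \<open>r\<close>, so \<open>?A\<close> lies in a translate of a
      finite set.\<close>
    have "?A \<subseteq> (\<lambda>\<gamma>. s\<^sub>0 \<circ> \<gamma>) ` {\<gamma> \<in> \<Gamma>. dist y (\<gamma> y) < r}"
    proof
      fix s assume s: "s \<in> ?A"
      have "dist (iso_inv s\<^sub>0 (s y)) y = dist (s y) (s\<^sub>0 y)"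
        by (rule dist_inv[OF s\<^sub>0(1)])
      also have "\<dots> < r"
        using s s\<^sub>0(2) dist_triangle3[of "s y" "s\<^sub>0 y" x] by simp
      finally have "iso_inv s\<^sub>0 \<circ> s \<in> {\<gamma> \<in> \<Gamma>. dist y (\<gamma> y) < r}"
        using s s\<^sub>0 comp_closed[OF inv_closed[OF s\<^sub>0(1)], of s] dist_commute[of y] by simp
      moreover have "s = s\<^sub>0 \<circ> (iso_inv s\<^sub>0 \<circ> s)"
        using s\<^sub>0 by (simp add: fun_eq_iff)
      ultimately show "s \<in> (\<lambda>\<gamma>. s\<^sub>0 \<circ> \<gamma>) ` {\<gamma> \<in> \<Gamma>. dist y (\<gamma> y) < r}"
        by blast
    qed
    moreover have "finite {\<gamma> \<in> \<Gamma>. dist y (\<gamma> y) < r}"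
      using r(2) that D(1) by blast
    ultimately show ?thesis
      by (meson finite_imageI finite_subset)
  next
    case True
    then show ?thesis
      by (simp only: finite.emptyI)
  qed
  have "near (r / 6) \<subseteq> (\<Union>x\<in>D. \<Union>y\<in>D. {s \<in> \<Gamma>. dist x (s y) < r / 2})"
  proof
    fix s assume "s \<in> near (r / 6)"
    then obtain k k' where s: "s \<in> \<Gamma>" "k \<in> K" "k' \<in> K" "dist k (s k') < r / 6"
      by (auto simp: near_def)
    obtain x where x: "x \<in> D" "dist x k < r / 6"
      using s(2) D(3) by auto
    obtain y where y: "y \<in> D" "dist y k' < r / 6"
      using s(3) D(3) by auto
    have "dist x (s y) \<le> dist x k + dist k (s k') + dist (s k') (s y)"
      using dist_triangle[of x "s y" k] dist_triangle[of k "s y" "s k'"] by simp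
    also have "dist (s k') (s y) = dist y k'"
      using isometry[OF s(1)] by (simp add: dist_commute)
    finally have "dist x (s y) < r / 2"
      using s x y by simp
    with s x y show "s \<in> (\<Union>x\<in>D. \<Union>y\<in>D. {s \<in> \<Gamma>. dist x (s y) < r / 2})"
      by blast
  qed
  moreover have "finite (\<Union>x\<in>D. \<Union>y\<in>D. {s \<in> \<Gamma>. dist x (s y) < r / 2})"
    using D(2) fin by blast
  ultimately have "finite (near (r / 6))"
    by (rule finite_subset)
  with r(1) show thesis
    by (intro that[of "r / 6"]) auto
qed

text \<open>Cut a geodesic from \<open>k\<close> to \<open>s k'\<close> and move the cutting point into \<open>K\<close>.\<close>

lemma near_add:
  assumes "r > 0" "t > 0" "s \<in> near (r + t)"
  obtains \<gamma> \<gamma>' where "\<gamma> \<in> near r" "\<gamma>' \<in> near t" "s = \<gamma> \<circ> \<gamma>'"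
proof -
  obtain k k' where s: "s \<in> \<Gamma>" "k \<in> K" "k' \<in> K" "dist k (s k') < r + t"
    using assms(3) by (auto simp: near_def)
  \<comment> \<open>With this ratio, a total length below \<open>r + t\<close> splits into pieces
    strictly below \<open>r\<close> and \<open>t\<close>.\<close>
  obtain z where z: "dist k z = r / (r + t) * dist k (s k')"
      "dist z (s k') = (1 - r / (r + t)) * dist k (s k')"
    using geodesic_division[OF geodesic, of "r / (r + t)" k "s k'"] assms(1,2) by auto
  have ratio: "dist k (s k') / (r + t) < 1"
    using s(4) assms(1,2) by simp
  have "dist k z < r"
    using z(1) mult_strict_left_mono[OF ratio assms(1)] by simp
  have "1 - r / (r + t) = t / (r + t)"
    using assms(1,2) by (simp add: field_simps)
  then have "dist z (s k') < t"
    using z(2) mult_strict_left_mono[OF ratio assms(2)] by simp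
  obtain \<gamma> k'' where \<gamma>: "\<gamma> \<in> \<Gamma>" "k'' \<in> K" "z = \<gamma> k''"
    by (rule translate_into_K)
  have "\<gamma> \<in> near r"
    using \<gamma> s \<open>dist k z < r\<close> by (auto simp: near_def)
  moreover have "iso_inv \<gamma> \<circ> s \<in> near t"
  proof -
    have "dist (iso_inv \<gamma> (s k')) k'' = dist (s k') z"
      using dist_inv[OF \<gamma>(1)] \<gamma>(3) by simp
    then have "dist k'' ((iso_inv \<gamma> \<circ> s) k') < t"
      using \<open>dist z (s k') < t\<close> by (simp add: dist_commute[of k''] dist_commute[of z])
    then show ?thesis
      using comp_closed[OF inv_closed[OF \<gamma>(1)] s(1)] \<gamma>(2) s(3) unfolding near_def by blast
  qed
  moreover have "s = \<gamma> \<circ> (iso_inv \<gamma> \<circ> s)"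
    using \<gamma> by (simp add: fun_eq_iff)
  ultimately show thesis
    by (rule that)
qed

lemma near_mono: "r \<le> t \<Longrightarrow> near r \<subseteq> near t"
  by (force simp: near_def)

text \<open>Each step splits off one factor from \<open>near \<delta>\<close> by
  \<open>near_add\<close>. Counting from \<open>Suc n\<close> keeps both radii positive, as that
  splitting demands.\<close>

lemma near_multiple:
  assumes "\<delta> > 0" "finite (near \<delta>)"
  shows "finite (near (real (Suc n) * \<delta>)) \<and> near (real (Suc n) * \<delta>) \<subseteq> generate iso_group (near \<delta>)"
proof (induction n)
  case 0
  then show ?case
    using assms by (auto intro: generate.incl)
next
  case (Suc n)
  have eq: "real (Suc (Suc n)) * \<delta> = \<delta> + real (Suc n) * \<delta>"
    by (simp add: algebra_simps)
  have "near (real (Suc (Suc n)) * \<delta>) \<subseteq> (\<lambda>(a, b). a \<circ> b) ` (near \<delta> \<times> near (real (Suc n) * \<delta>))"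
  proof
    fix s assume "s \<in> near (real (Suc (Suc n)) * \<delta>)"
    then obtain a b where "a \<in> near \<delta>" "b \<in> near (real (Suc n) * \<delta>)" "s = a \<circ> b"
      unfolding eq using near_add[of \<delta> "real (Suc n) * \<delta>" s] assms by auto
    then show "s \<in> (\<lambda>(a, b). a \<circ> b) ` (near \<delta> \<times> near (real (Suc n) * \<delta>))"
      by force
  qed
  moreover have "finite ((\<lambda>(a, b). a \<circ> b) ` (near \<delta> \<times> near (real (Suc n) * \<delta>)))"
    using Suc assms by blast
  moreover have "a \<circ> b \<in> generate iso_group (near \<delta>)" if "a \<in> near \<delta>" "b \<in> near (real (Suc n) * \<delta>)" for a b
    using generate.eng[of a iso_group "near \<delta>" b] generate.incl[of a "near \<delta>" iso_group] Suc that by auto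
  ultimately show ?case
    by (auto intro: finite_subset)
qed

text \<open>Properness speaks only about small radii; factoring along geodesics extends finiteness
  to all of them.\<close>

lemma finite_near: "finite (near r)"
proof -
  obtain \<delta> where \<delta>: "\<delta> > 0" "finite (near \<delta>)"
    by (rule finite_near_small)
  obtain n where "r < real n * \<delta>"
    using reals_Archimedean3[OF \<delta>(1)] by blast
  also have "\<dots> \<le> real (Suc n) * \<delta>"
    using \<delta>(1) by simp
  finally show ?thesis
    using near_multiple[OF \<delta>, of n] near_mono[of r "real (Suc n) * \<delta>"] by (auto intro: finite_subset)
qed

text \<open>Any \<open>g\<close> moves a fixed point of \<open>K\<close> some finite distance, hence
  lies in a \<open>near\<close> set of large radius, and these are generated by
  \<open>near \<delta>\<close>.\<close>

lemma \<Gamma>_finitely_generated: "finitely_generated (iso_group\<lparr>carrier := \<Gamma>\<rparr>)"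
proof -
  obtain \<delta> where \<delta>: "\<delta> > 0" "finite (near \<delta>)"
    by (rule finite_near_small)
  have near: "near \<delta> \<subseteq> \<Gamma>"
    by (auto simp: near_def)
  have "\<Gamma> \<subseteq> generate iso_group (near \<delta>)"
  proof
    fix g assume "g \<in> \<Gamma>"
    obtain k where "k \<in> K"
      using K_nonempty by blast
    obtain n where "dist k (g k) < real n * \<delta>"
      using reals_Archimedean3[OF \<delta>(1)] by blast
    also have "\<dots> \<le> real (Suc n) * \<delta>"
      using \<delta>(1) by simp
    finally have "g \<in> near (real (Suc n) * \<delta>)"
      using \<open>g \<in> \<Gamma>\<close> \<open>k \<in> K\<close> by (auto simp: near_def)
    then show "g \<in> generate iso_group (near \<delta>)"
      using near_multiple[OF \<delta>, of n] by blast
  qed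
  moreover have "generate iso_group (near \<delta>) \<subseteq> \<Gamma>"
    by (rule group.generate_subgroup_incl[OF group_iso_group near subgroup])
  ultimately have "generate (iso_group\<lparr>carrier := \<Gamma>\<rparr>) (near \<delta>) = \<Gamma>"
    using group.generate_consistent[OF group_iso_group near subgroup] by blast
  then show ?thesis
    using \<delta> near by (auto simp: finitely_generated_def finite_generating_set_def)
qed

text \<open>The minimum runs over \<open>K\<close> only, so it may differ between conjugate
  elements; the minimum over the whole space arises by varying the conjugate.\<close>

definition min_displacement :: "('a \<Rightarrow> 'a) \<Rightarrow> real" where
  "min_displacement g = Inf ((\<lambda>x. dist x (g x)) ` K)"

lemma min_displacement_le: "x \<in> K \<Longrightarrow> min_displacement g \<le> dist x (g x)"
  unfolding min_displacement_def by (intro cInf_lower bdd_belowI[of _ 0]) auto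

lemma min_displacement_attained:
  assumes "g \<in> \<Gamma>"
  obtains k where "k \<in> K" "dist k (g k) = min_displacement g"
proof -
  have "continuous_on K g"
    using isometry[OF assms] by (intro lipschitz_on_continuous_on[of 1]) (simp add: lipschitz_on_def)
  then have "continuous_on K (\<lambda>x. dist x (g x))"
    by (intro continuous_intros)
  from continuous_attains_inf[OF compact_K K_nonempty this]
  obtain k where k: "k \<in> K" "\<And>x. x \<in> K \<Longrightarrow> dist k (g k) \<le> dist x (g x)"
    by blast
  then have "min_displacement g = dist k (g k)"
    unfolding min_displacement_def by (intro cInf_eq_minimum) auto
  with k show thesis
    by (intro that) auto
qed

text \<open>The element \<open>g\<close> displaces \<open>\<gamma> k\<close> as far as its conjugate
  displaces \<open>k\<close>, so all points can be moved into \<open>K\<close> at the price of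
  conjugating. Only finitely many conjugates compete for the minimum. The last conclusion later
  limits the possible values of small minima.\<close>

lemma displacement_min_attained:
  assumes "g \<in> \<Gamma>"
  obtains y \<gamma> where "\<gamma> \<in> \<Gamma>" "\<And>z. dist y (g y) \<le> dist z (g z)"
    "dist y (g y) = min_displacement (iso_inv \<gamma> \<circ> g \<circ> \<gamma>)"
proof -
  define c where "c \<gamma> = iso_inv \<gamma> \<circ> g \<circ> \<gamma>" for \<gamma>
  have c: "c \<gamma> \<in> \<Gamma>" "dist x (c \<gamma> x) = dist (\<gamma> x) (g (\<gamma> x))" if "\<gamma> \<in> \<Gamma>" for \<gamma> x
    using that assms comp_closed inv_closed dist_inv[OF that, of "g (\<gamma> x)" x]
    by (simp_all add: c_def dist_commute)
  obtain k\<^sub>0 where k\<^sub>0: "k\<^sub>0 \<in> K"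
    using K_nonempty by blast
  \<comment> \<open>The added 1 puts \<open>g\<close> itself into \<open>A\<close>. A conjugate
    outside \<open>A\<close> displaces every point of \<open>K\<close> by at least \<open>R\<close>,
    so it cannot beat \<open>k\<^sub>0\<close>.\<close>
  define R where "R = dist k\<^sub>0 (g k\<^sub>0) + 1"
  define A where "A = c ` \<Gamma> \<inter> near R"
  have "finite A"
    using finite_near by (simp add: A_def)
  have A: "c \<gamma> \<in> A" if "\<gamma> \<in> \<Gamma>" "k \<in> K" "dist k (c \<gamma> k) < R" for \<gamma> k
    using that c(1) by (auto simp: A_def near_def)
  have c_id: "c id = g"
    using inv_apply(1)[OF id_closed] by (simp add: c_def fun_eq_iff)
  have "g \<in> A"
    using A[OF id_closed k\<^sub>0] by (simp add: c_id R_def)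
  then have "Min (min_displacement ` A) \<in> min_displacement ` A"
    using \<open>finite A\<close> by (intro Min_in) auto
  then obtain h where h: "h \<in> A" "min_displacement h = Min (min_displacement ` A)"
    by auto
  then have h_le: "min_displacement h \<le> min_displacement h'" if "h' \<in> A" for h'
    using \<open>finite A\<close> that by simp
  obtain \<gamma> where \<gamma>: "\<gamma> \<in> \<Gamma>" "h = c \<gamma>"
    using h(1) by (auto simp: A_def)
  obtain k where k: "k \<in> K" "dist k (c \<gamma> k) = min_displacement (c \<gamma>)"
    by (rule min_displacement_attained[OF c(1)[OF \<gamma>(1)]])
  have le: "min_displacement (c \<gamma>) \<le> dist z (g z)" for z
  proof -
    obtain \<gamma>' k' where k': "\<gamma>' \<in> \<Gamma>" "k' \<in> K" "z = \<gamma>' k'"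
      by (rule translate_into_K)
    show ?thesis
    proof (cases "c \<gamma>' \<in> A")
      case True
      then have "min_displacement (c \<gamma>) \<le> min_displacement (c \<gamma>')"
        using h_le \<gamma> by blast
      also have "\<dots> \<le> dist k' (c \<gamma>' k')"
        by (rule min_displacement_le[OF k'(2)])
      finally show ?thesis
        using c(2)[OF k'(1)] k'(3) by simp
    next
      case False
      then have "R \<le> dist k' (c \<gamma>' k')"
        using A[OF k'(1,2)] by force
      moreover have "min_displacement (c \<gamma>) \<le> min_displacement g"
        using h_le \<open>g \<in> A\<close> \<gamma> by blast
      moreover have "min_displacement g \<le> dist k\<^sub>0 (g k\<^sub>0)"
        by (rule min_displacement_le[OF k\<^sub>0])
      ultimately show ?thesis
        using c(2)[OF k'(1)] k'(3) by (simp add: R_def)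
    qed
  qed
  show thesis
  proof (rule that[OF \<gamma>(1), of "\<gamma> k"])
    show "dist (\<gamma> k) (g (\<gamma> k)) = min_displacement (iso_inv \<gamma> \<circ> g \<circ> \<gamma>)"
      using k c(2)[OF \<gamma>(1)] by (simp add: c_def)
    then show "dist (\<gamma> k) (g (\<gamma> k)) \<le> dist z (g z)" for z
      using le[of z] by (simp add: c_def)
  qed
qed

section \<open>Translation lengths of elements of infinite order\<close>

lemma pow_closed: "g \<in> \<Gamma> \<Longrightarrow> g ^^ n \<in> \<Gamma>"
  by (induction n) (auto simp: id_closed comp_closed)

text \<open>A fixed point would have zero displacement under infinitely many powers, against
  properness.\<close>

lemma infinite_order_no_fixpoint:
  assumes "g \<in> \<Gamma>" "inj (\<lambda>n::nat. g ^^ n)"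
  shows "g y \<noteq> y"
proof
  assume "g y = y"
  then have fix_pow: "(g ^^ n) y = y" for n
    by (induction n) auto
  obtain r where "r > 0" "finite {\<gamma> \<in> \<Gamma>. dist y (\<gamma> y) < r}"
    using proper unfolding proper_action_def by blast
  moreover have "range (\<lambda>n. g ^^ n) \<subseteq> {\<gamma> \<in> \<Gamma>. dist y (\<gamma> y) < r}"
    using pow_closed[OF assms(1)] fix_pow \<open>r > 0\<close> by auto
  ultimately have "finite (range (\<lambda>n. g ^^ n))"
    by (meson finite_subset)
  then show False
    using assms(2) finite_imageD infinite_UNIV_nat by blast
qed

text \<open>A minimal displacement below 1 is the \<open>min_displacement\<close> of a conjugate in
  the finite set \<open>near 1\<close>, so only finitely many values occur there, and infinite order
  makes them positive.\<close>

lemma translation_length_bounded_below: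
  obtains \<epsilon> where "\<epsilon> > 0"
    "\<And>g. g \<in> \<Gamma> \<Longrightarrow> inj (\<lambda>n::nat. g ^^ n) \<Longrightarrow> \<exists>y. \<forall>n. real n * \<epsilon> \<le> dist y ((g ^^ n) y)"
proof -
  \<comment> \<open>The inserted 1 covers minimal displacements of at least 1 and keeps
    \<open>V\<close> nonempty.\<close>
  define V where "V = insert 1 (min_displacement ` near 1 \<inter> {0<..})"
  define \<epsilon> where "\<epsilon> = Min V"
  have V: "finite V" "V \<noteq> {}"
    using finite_near by (auto simp: V_def)
  have "\<epsilon> \<in> V"
    unfolding \<epsilon>_def using V by (rule Min_in)
  then have "\<epsilon> > 0"
    by (auto simp: V_def)
  moreover have "\<exists>y. \<forall>n. real n * \<epsilon> \<le> dist y ((g ^^ n) y)"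
    if g: "g \<in> \<Gamma>" "inj (\<lambda>n::nat. g ^^ n)" for g
  proof -
    obtain y \<gamma> where \<gamma>: "\<gamma> \<in> \<Gamma>" and min: "\<And>z. dist y (g y) \<le> dist z (g z)"
      and y: "dist y (g y) = min_displacement (iso_inv \<gamma> \<circ> g \<circ> \<gamma>)"
      by (rule displacement_min_attained[OF g(1)]) blast
    let ?h = "iso_inv \<gamma> \<circ> g \<circ> \<gamma>"
    have h: "?h \<in> \<Gamma>"
      using \<gamma> g comp_closed inv_closed by blast
    have "\<epsilon> \<le> dist y (g y)"
    proof (cases "dist y (g y) < 1")
      case True
      obtain k where k: "k \<in> K" "dist k (?h k) = min_displacement ?h"
        by (rule min_displacement_attained[OF h])
      then have "?h \<in> near 1"
        using h True y unfolding near_def by (intro CollectI conjI bexI[of _ k]) simp_all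
      moreover have "dist y (g y) > 0"
        using infinite_order_no_fixpoint[OF g, of y] by simp
      ultimately have "dist y (g y) \<in> V"
        unfolding V_def y by blast
      then show ?thesis
        unfolding \<epsilon>_def using V(1) by simp
    next
      case False
      moreover have "\<epsilon> \<le> 1"
        unfolding \<epsilon>_def using V(1) by (intro Min_le) (auto simp: V_def)
      ultimately show ?thesis
        by simp
    qed
    then have "real n * \<epsilon> \<le> real n * dist y (g y)" for n
      by (simp add: mult_left_mono)
    also have "real n * dist y (g y) \<le> dist y ((g ^^ n) y)" for n
      by (rule displacement_minimizer_growth[OF geodesic ptolemy isometry[OF g(1)] min])
    finally show ?thesis
      by blast
  qed
  ultimately show thesis
    by (rule that)
qed

end

section \<open>Free abelian subgroups\<close>

context ptolemy_action
begin

lemma free_abelian_displacement_ge: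
  assumes H: "subgroup H iso_group" "H \<subseteq> \<Gamma>" and B: "finite B"
    and \<phi>: "\<phi> \<in> iso (free_Abelian_group B) (iso_group\<lparr>carrier := H\<rparr>)"
  obtains c where "c > 0"
    "\<And>u. Poly_Mapping.keys u \<subseteq> B \<Longrightarrow>
      c * (\<Sum>b\<in>B. \<bar>real_of_int (Poly_Mapping.lookup u b)\<bar>) \<le> dist x (\<phi> u x)"
proof -
  interpret iso: group "iso_group :: ('a \<Rightarrow> 'a) monoid"
    by (rule group_iso_group)
  have \<phi>_hom: "\<phi> \<in> hom (free_Abelian_group B) iso_group"
    using \<phi> subgroup.subset[OF H(1)] by (fastforce simp: iso_def hom_def)
  interpret \<phi>: group_hom "free_Abelian_group B" iso_group \<phi>
    using \<phi>_hom by (simp add: group_hom_def group_hom_axioms_def)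
  have \<phi>_inj: "inj_on \<phi> (carrier (free_Abelian_group B))" and \<phi>_in: "\<phi> w \<in> \<Gamma>" if "Poly_Mapping.keys w \<subseteq> B" for w
    using \<phi> H(2) that by (auto simp: iso_def bij_betw_def)
  have keys_mul: "Poly_Mapping.keys (frag_cmul z w) \<subseteq> B" if "Poly_Mapping.keys w \<subseteq> B" for z w
    using keys_cmul[of z w] that by blast
  have \<phi>_pow: "\<phi> (frag_cmul (int n) w) = \<phi> w ^^ n" if w: "Poly_Mapping.keys w \<subseteq> B" for n w
  proof (induction n)
    case 0
    show ?case
      using \<phi>.hom_one by simp
  next
    case (Suc n)
    have "frag_cmul (int (Suc n)) w = w + frag_cmul (int n) w"
      by (simp add: frag_cmul_distrib)
    then show ?case
      using \<phi>.hom_mult[of w "frag_cmul (int n) w"] w keys_mul[OF w] Suc by simp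
  qed
  obtain \<epsilon> where \<epsilon>: "\<epsilon> > 0"
    "\<And>g. g \<in> \<Gamma> \<Longrightarrow> inj (\<lambda>n::nat. g ^^ n) \<Longrightarrow> \<exists>y. \<forall>n. real n * \<epsilon> \<le> dist y ((g ^^ n) y)"
    by (rule translation_length_bounded_below) blast
  have growth: "\<exists>C. \<forall>k::nat. real k * \<epsilon> \<le> dist x (\<phi> (frag_cmul (int k) w) x) + C"
    if w: "Poly_Mapping.keys w \<subseteq> B" "w \<noteq> 0" for w
  proof -
    \<comment> \<open>Free abelian groups are torsion-free: a nonzero coordinate of \<open>w\<close>
      tells its multiples apart.\<close>
    have "inj (\<lambda>n::nat. \<phi> w ^^ n)"
    proof (rule injI)
      fix m n :: nat assume "\<phi> w ^^ m = \<phi> w ^^ n"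
      then have "\<phi> (frag_cmul (int m) w) = \<phi> (frag_cmul (int n) w)"
        by (simp add: \<phi>_pow[OF w(1)])
      then have eq: "frag_cmul (int m) w = frag_cmul (int n) w"
        using inj_onD[OF \<phi>_inj[OF w(1)]] keys_mul[OF w(1)] by simp
      obtain b where "Poly_Mapping.lookup w b \<noteq> 0"
        using w(2) by (metis lookup_zero poly_mapping_eqI)
      then show "m = n"
        using arg_cong[OF eq, of "\<lambda>v. Poly_Mapping.lookup v b"] by simp
    qed
    then obtain y where y: "\<And>n. real n * \<epsilon> \<le> dist y ((\<phi> w ^^ n) y)"
      using \<epsilon>(2)[OF \<phi>_in[OF w(1)]] by blast
    \<comment> \<open>The point \<open>y\<close> depends on \<open>w\<close>. Changing to the common
      base point \<open>x\<close> costs \<open>2 * dist x y\<close>, which does not depend on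
      \<open>k\<close>.\<close>
    have "real k * \<epsilon> \<le> dist x (\<phi> (frag_cmul (int k) w) x) + 2 * dist x y" for k
    proof -
      let ?g = "\<phi> w ^^ k"
      have "dist (?g x) (?g y) = dist x y"
        by (rule isometry[OF pow_closed[OF \<phi>_in[OF w(1)]]])
      then have "dist y (?g y) \<le> dist x (?g x) + 2 * dist x y"
        using dist_triangle[of y "?g y" x] dist_triangle[of x "?g y" "?g x"] by (simp add: dist_commute[of y x])
      then show ?thesis
        using y[of k] by (simp add: \<phi>_pow[OF w(1)])
    qed
    then show ?thesis
      by blast
  qed
  have "length_function (free_Abelian_group B) ((\<lambda>g. dist x (g x)) \<circ> \<phi>)"
    by (rule iso.length_function_hom[OF _ \<phi>_hom length_function_displacement]) simp
  then obtain c where "c > 0"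
    "\<And>u. Poly_Mapping.keys u \<subseteq> B \<Longrightarrow>
      c * (\<Sum>b\<in>B. \<bar>real_of_int (Poly_Mapping.lookup u b)\<bar>) \<le> ((\<lambda>g. dist x (g x)) \<circ> \<phi>) u"
    using length_function_free_abelian_ge[OF B _ \<epsilon>(1), of "(\<lambda>g. dist x (g x)) \<circ> \<phi>"] growth by auto
  then show thesis
    using that by simp
qed

text \<open>The sum of absolute coordinates mediates: it bounds the word norm from above up to a
  factor \<open>C\<close>, and after scaling by \<open>c\<close> it is bounded by the
  displacement.\<close>

lemma free_abelian_subgroup_word_norm_le:
  assumes H: "subgroup H iso_group" "H \<subseteq> \<Gamma>"
    and T: "finite_generating_set (iso_group\<lparr>carrier := H\<rparr>) T"
    and free: "free_abelian (iso_group\<lparr>carrier := H\<rparr>)"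
  obtains c where "c \<ge> 0"
    "\<And>h. h \<in> H \<Longrightarrow> real (word_norm (iso_group\<lparr>carrier := H\<rparr>) T h) \<le> c * dist x (h x)"
proof -
  let ?H = "iso_group\<lparr>carrier := H\<rparr>"
  interpret H: group ?H
    by (rule group.subgroup_imp_group[OF group_iso_group H(1)])
  have "finitely_generated ?H"
    using T by (auto simp: finitely_generated_def)
  then obtain B :: "('a \<Rightarrow> 'a) set" and \<psi> where B: "finite B" and \<psi>: "\<psi> \<in> iso ?H (free_Abelian_group B)"
    using fg_free_abelian_basis[OF H.is_group _ free] by blast
  define \<phi> where "\<phi> = inv_into (carrier ?H) \<psi>"
  have \<phi>: "\<phi> \<in> iso (free_Abelian_group B) ?H"
    unfolding \<phi>_def by (rule H.iso_set_sym[OF \<psi>])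
  obtain c where c: "c > 0" "\<And>u. Poly_Mapping.keys u \<subseteq> B \<Longrightarrow>
      c * (\<Sum>b\<in>B. \<bar>real_of_int (Poly_Mapping.lookup u b)\<bar>) \<le> dist x (\<phi> u x)"
    by (rule free_abelian_displacement_ge[OF H B \<phi>]) blast
  let ?l = "(\<lambda>g. real (word_norm ?H T g)) \<circ> \<phi>"
  have l: "length_function (free_Abelian_group B) ?l"
    using \<phi> by (intro H.length_function_hom H.length_function_word_norm T) (auto simp: iso_def)
  define C where "C = (\<Sum>b\<in>B. ?l (frag_of b))"
  have "C \<ge> 0"
    unfolding C_def by (intro sum_nonneg) simp
  have "real (word_norm ?H T h) \<le> C / c * dist x (h x)" if h: "h \<in> H" for h
  proof -
    let ?u = "\<psi> h"
    have "?u \<in> carrier (free_Abelian_group B)"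
      using \<psi> h by (intro hom_in_carrier[of \<psi> ?H]) (auto simp: iso_def)
    moreover have "\<phi> ?u = h"
      using \<psi> h by (auto simp: iso_def bij_betw_def \<phi>_def)
    ultimately have u: "Poly_Mapping.keys ?u \<subseteq> B" "\<phi> ?u = h"
      by simp_all
    have "?l ?u \<le> (\<Sum>b\<in>B. \<bar>real_of_int (Poly_Mapping.lookup ?u b)\<bar> * ?l (frag_of b))"
      by (rule length_function_free_abelian_le[OF B l u(1)])
    also have "\<dots> \<le> (\<Sum>b\<in>B. \<bar>real_of_int (Poly_Mapping.lookup ?u b)\<bar> * C)"
      unfolding C_def using B by (intro sum_mono mult_left_mono member_le_sum) auto
    also have "\<dots> = C / c * (c * (\<Sum>b\<in>B. \<bar>real_of_int (Poly_Mapping.lookup ?u b)\<bar>))"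
      using c(1) by (simp add: sum_distrib_left mult.commute)
    also have "\<dots> \<le> C / c * dist x (\<phi> ?u x)"
      using c(1) c(2)[OF u(1)] \<open>C \<ge> 0\<close> by (intro mult_left_mono) auto
    finally show ?thesis
      using u(2) by simp
  qed
  moreover have "C / c \<ge> 0"
    using \<open>C \<ge> 0\<close> c(1) by simp
  ultimately show thesis
    using that by blast
qed

lemma free_abelian_subgroup_straight:
  assumes H: "subgroup H (iso_group\<lparr>carrier := \<Gamma>\<rparr>)"
    and fg: "finitely_generated (iso_group\<lparr>carrier := H\<rparr>)"
    and free: "free_abelian (iso_group\<lparr>carrier := H\<rparr>)"
  shows "straight (iso_group\<lparr>carrier := \<Gamma>\<rparr>) H"
proof -
  let ?G = "iso_group\<lparr>carrier := \<Gamma>\<rparr>" and ?H = "iso_group\<lparr>carrier := H\<rparr>"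
  interpret iso: group "iso_group :: ('a \<Rightarrow> 'a) monoid"
    by (rule group_iso_group)
  interpret G: group ?G
    by (rule iso.subgroup_imp_group[OF subgroup])
  have H_sub: "H \<subseteq> \<Gamma>"
    using subgroup.subset[OF H] by simp
  have H_iso: "subgroup H iso_group"
    by (rule iso.incl_subgroup[OF subgroup H])
  interpret H: group ?H
    by (rule iso.subgroup_imp_group[OF H_iso])
  have "equivalent_norms_on H (\<lambda>g. real (word_norm ?H T g)) (\<lambda>g. real (word_norm ?G S g))"
    if S: "finite_generating_set ?G S" and T: "finite_generating_set ?H T" for S T
  proof -
    have "(\<lambda>g. g) \<in> hom ?H ?G" "(\<lambda>g. g) \<in> hom ?G iso_group"
      using H_sub subgroup.subset[OF subgroup] by (auto simp: hom_def)
    then have lG: "length_function ?H (\<lambda>g. real (word_norm ?G S g))"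
      and lX: "length_function ?G (\<lambda>g. dist x (g x))" for x
      using G.length_function_hom[OF H.is_group _ G.length_function_word_norm[OF S]]
        iso.length_function_hom[OF G.is_group _ length_function_displacement]
      by (simp_all add: comp_def)
    obtain x\<^sub>0 :: 'a where "x\<^sub>0 \<in> K"
      using K_nonempty by blast
    obtain a where a: "a \<ge> 0" "\<And>h. h \<in> H \<Longrightarrow> real (word_norm ?G S h) \<le> a * real (word_norm ?H T h)"
      using H.length_function_le_word_norm[OF T lG] by auto
    obtain b where b: "b \<ge> 0" "\<And>g. g \<in> \<Gamma> \<Longrightarrow> dist x\<^sub>0 (g x\<^sub>0) \<le> b * real (word_norm ?G S g)"
      using G.length_function_le_word_norm[OF S lX] by auto
    obtain c where c: "c \<ge> 0" "\<And>h. h \<in> H \<Longrightarrow> real (word_norm ?H T h) \<le> c * dist x\<^sub>0 (h x\<^sub>0)"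
      by (rule free_abelian_subgroup_word_norm_le[OF H_iso H_sub T free]) blast
    \<comment> \<open>One constant for both directions: \<open>a\<close> is the easy comparison,
      \<open>c * b\<close> the detour through the displacement of the base point, and the 1 ensures
      \<open>e \<ge> 1\<close>.\<close>
    define e where "e = 1 + a + c * b"
    have e: "e \<ge> 1" "a \<le> e" "c * b \<le> e"
      using a(1) b(1) c(1) by (auto simp: e_def)
    have "(1 / e) * real (word_norm ?H T h) \<le> real (word_norm ?G S h) \<and>
        real (word_norm ?G S h) \<le> e * real (word_norm ?H T h)" if h: "h \<in> H" for h
    proof
      have "real (word_norm ?H T h) \<le> c * dist x\<^sub>0 (h x\<^sub>0)"
        by (rule c(2)[OF h])
      also have "\<dots> \<le> c * (b * real (word_norm ?G S h))"
        using b(2)[of h] h H_sub c(1) by (intro mult_left_mono) auto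
      also have "\<dots> \<le> e * real (word_norm ?G S h)"
        using mult_right_mono[OF e(3), of "real (word_norm ?G S h)"] by (simp add: mult.assoc)
      finally show "(1 / e) * real (word_norm ?H T h) \<le> real (word_norm ?G S h)"
        using e(1) by (simp add: field_simps)
      show "real (word_norm ?G S h) \<le> e * real (word_norm ?H T h)"
        using a(2)[OF h] mult_right_mono[OF e(2), of "real (word_norm ?H T h)"] by linarith
    qed
    then show ?thesis
      unfolding equivalent_norms_on_def using e(1) by blast
  qed
  then show ?thesis
    unfolding straight_def using H fg \<Gamma>_finitely_generated by simp
qed

end

theorem theorem1p3:
  fixes \<Gamma> :: "('a::metric_space \<Rightarrow> 'a) set"
  assumes "geodesic_space (UNIV :: 'a set)"
    and "ptolemy (UNIV :: 'a set)"
    and "subgroup \<Gamma> iso_group"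
    and "proper_action \<Gamma>"
    and "cocompact_action \<Gamma>"
  shows "\<forall>H. subgroup H (iso_group\<lparr>carrier := \<Gamma>\<rparr>) \<longrightarrow>
    finitely_generated (iso_group\<lparr>carrier := H\<rparr>) \<longrightarrow>
    free_abelian (iso_group\<lparr>carrier := H\<rparr>) \<longrightarrow>
    straight (iso_group\<lparr>carrier := \<Gamma>\<rparr>) H"
proof -
  interpret ptolemy_action \<Gamma>
    by (rule ptolemy_action.intro[OF assms])
  show ?thesis
    using free_abelian_subgroup_straight by blast
qed

end
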